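(* Let $n\ge1$ be an integer and consider $\tilde\psi_n(a,d,y)\in\mathbb{Z}[a,d,y]$ as a polynomial in three variables. Then $$\tilde\psi_n(a,d,y)=\tilde\psi_n^*(-d,-a,y).$$
   Context: Let $m(n)=\frac{n^2-1}{2}$ if $n$ is odd and $m(n)=\frac{n^2-2}{2}$ if $n$ is even. The polynomial $\tilde\psi_n(a,d,y)$ has degree at most $m(n)$ in $y$; write $\tilde\psi_n(a,d,y)=\alpha_{m(n)}y^{m(n)}+\alpha_{m(n)-1}y^{m(n)-1}+\dots+\alpha_1y+\alpha_0$ with $\alpha_i=\alpha_i(a,d)\in\mathbb{Z}[a,d]$ (if $4\mid n$, then $\alpha_{m(n)}=\alpha_0=0$). Define $$\tilde\psi_n^*(a,d,y)=\alpha_0y^{m(n)}+\alpha_1y^{m(n)-1}+\dots+\alpha_{m(n)-1}y+\alpha_{m(n)}.$$ Thus $\tilde\psi_n^*(-d,-a,y)$ is obtained from $\tilde\psi_n^*(a,d,y)$ by simultaneously substituting $a\mapsto-d$, $d\mapsto-a$. Here $a,d,y$ are regarded as indeterminates, and the $\tilde\psi_n=\tilde\psi_n(a,d,y)$ are the elements of $\mathbb{Q}(a,d,y)$ (they in fact lie in $\mathbb{Z}[a,d,y]$) defined recursively by $\tilde\psi_0=0$, $\tilde\psi_1=1$, $\tilde\psi_2=y+1$, $\tilde\psi_3=-dy^4-2dy^3+2ay+a$, $\tilde\psi_4=-2y(y+1)(dy^4-a)$, $$\tilde\psi_{2r+1}=\begin{cases}\dfrac{4(a-d)(a-dy^2)^2\tilde\psi_{r+2}\tilde\psi_r^3}{(y+1)^2}-\tilde\psi_{r-1}\tilde\psi_{r+1}^3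 & r\equiv0\pmod 4,\ r\ge4,\\[2mm] \tilde\psi_{r+2}\tilde\psi_r^3-\dfrac{4(a-dy^2)^2\tilde\psi_{r-1}\tilde\psi_{r+1}^3}{(y+1)^2} & r\equiv1\pmod 4,\ r\ge5,\\[2mm] \dfrac{4(a-dy^2)^2\tilde\psi_{r+2}\tilde\psi_r^3}{(y+1)^2}-\tilde\psi_{r-1}\tilde\psi_{r+1}^3 & r\equiv2\pmod 4,\ r\ge2,\\[2mm] \tilde\psi_{r+2}\tilde\psi_r^3-\dfrac{4(a-d)(a-dy^2)^2\tilde\psi_{r-1}\tilde\psi_{r+1}^3}{(y+1)^2} & r\equiv3\pmod 4,\ r\ge3,\end{cases}$$ $$\tilde\psi_{2r}=\begin{cases}\dfrac{\tilde\psi_r}{y+1}\left(\tilde\psi_{r+2}\tilde\psi_{r-1}^2-\tilde\psi_{r-2}\tilde\psi_{r+1}^2\right) & r\equiv0,2\pmod 4,\ r\ge4,\\[2mm] \dfrac{\tilde\psi_r}{y+1}\left((a-d)\tilde\psi_{r+2}\tilde\psi_{r-1}^2-\tilde\psi_{r-2}\tilde\psi_{r+1}^2\right) & r\equiv1\pmod 4,\ r\ge5,\\[2mm] \dfrac{\tilde\psi_r}{y+1}\left(\tilde\psi_{r+2}\tilde\psi_{r-1}^2-(a-d)\tilde\psi_{r-2}\tilde\psi_{r+1}^2\right) & r\equiv3\pmod 4,\ r\ge3.\end{cases}$$ *)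

theory Defs
  imports "HOL-Computational_Algebra.Computational_Algebra"
begin

text \<open>
  The ring \<open>\<int>[a,d,y]\<close> is the iterated polynomial ring \<open>\<int>[a][d][y]\<close>, so that a polynomial in
  \<open>y\<close> has its coefficients in \<open>\<int>[a,d]\<close>.  Its field of fractions is \<open>\<rat>(a,d,y)\<close>.
\<close>

type_synonym poly_ad = "int poly poly"
type_synonym poly_ady = "poly_ad poly"
type_synonym ratfun_ady = "poly_ady fract"

definition ind_a :: poly_ad where "ind_a = [:[:0, 1:]:]"
definition ind_d :: poly_ad where "ind_d = [:0, 1:]"

definition fa :: ratfun_ady where "fa = to_fract [:ind_a:]"
definition fd :: ratfun_ady where "fd = to_fract [:ind_d:]"
definition fy :: ratfun_ady where "fy = to_fract [:0, 1:]"

text \<open>For \<open>n \<ge> 5\<close> put \<open>r = n div 2\<close>, so that \<open>n = 2r + 1\<close> (\<open>r \<ge> 2\<close>) or \<open>n = 2r\<close> (\<open>r \<ge> 3\<close>).  The division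
  is carried out in the field \<open>\<rat>(a,d,y)\<close>.\<close>

function tpsi :: "nat \<Rightarrow> ratfun_ady" where
  "tpsi n =
    (if n = 0 then 0
     else if n = 1 then 1
     else if n = 2 then fy + 1
     else if n = 3 then - fd * fy ^ 4 - 2 * fd * fy ^ 3 + 2 * fa * fy + fa
     else if n = 4 then - 2 * fy * (fy + 1) * (fd * fy ^ 4 - fa)
     else (let r = n div 2 in
       if odd n then
         (if r mod 4 = 0 then
            4 * (fa - fd) * (fa - fd * fy ^ 2) ^ 2 * tpsi (r + 2) * tpsi r ^ 3 / (fy + 1) ^ 2
              - tpsi (r - 1) * tpsi (r + 1) ^ 3
          else if r mod 4 = 1 then
            tpsi (r + 2) * tpsi r ^ 3
              - 4 * (fa - fd * fy ^ 2) ^ 2 * tpsi (r - 1) * tpsi (r + 1) ^ 3 / (fy + 1) ^ 2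
          else if r mod 4 = 2 then
            4 * (fa - fd * fy ^ 2) ^ 2 * tpsi (r + 2) * tpsi r ^ 3 / (fy + 1) ^ 2
              - tpsi (r - 1) * tpsi (r + 1) ^ 3
          else
            tpsi (r + 2) * tpsi r ^ 3
              - 4 * (fa - fd) * (fa - fd * fy ^ 2) ^ 2 * tpsi (r - 1) * tpsi (r + 1) ^ 3
                / (fy + 1) ^ 2)
       else
         (if r mod 4 = 1 then
            tpsi r / (fy + 1) * ((fa - fd) * tpsi (r + 2) * tpsi (r - 1) ^ 2
              - tpsi (r - 2) * tpsi (r + 1) ^ 2)
          else if r mod 4 = 3 then
            tpsi r / (fy + 1) * (tpsi (r + 2) * tpsi (r - 1) ^ 2
              - (fa - fd) * tpsi (r - 2) * tpsi (r + 1) ^ 2)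
          else
            tpsi r / (fy + 1) * (tpsi (r + 2) * tpsi (r - 1) ^ 2
              - tpsi (r - 2) * tpsi (r + 1) ^ 2))))"
  by pat_completeness auto

lemma half_less:
  fixes n r :: nat
  assumes "n \<noteq> 0" "n \<noteq> 1" "n \<noteq> 2" "n \<noteq> 3" "n \<noteq> 4" "r = n div 2"
  shows "r + 2 < n" "r + 1 < n" "r < n" "r - 1 < n" "r - 2 < n"
  using assms by linarith+

termination
  apply (relation "measure id")
  apply (rule wf_measure)
  apply (unfold in_measure id_apply)
  apply (rule half_less; assumption)+
  done

declare tpsi.simps [simp del]

definition m_deg :: "nat \<Rightarrow> nat" where
  "m_deg n = (if odd n then (n ^ 2 - 1) div 2 else (n ^ 2 - 2) div 2)"

text \<open>\<open>\<psi>\<^sub>n\<close> as an element of \<open>\<int>[a,d,y]\<close>; that it lies there, and that its degree in \<open>y\<close> is at most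
  \<open>m(n)\<close>, is proved below (\<open>tpsi_integral\<close>, \<open>degree_tpsi_poly\<close>).\<close>

definition tpsi_poly :: "nat \<Rightarrow> poly_ady" where
  "tpsi_poly n = (THE P. to_fract P = tpsi n)"

text \<open>The reversal is relative to \<open>m(n)\<close>, not to the actual degree (the two differ if \<open>4\<close> divides
  \<open>n\<close>), so \<open>reflect_poly\<close> is not the right notion.\<close>

definition tpsi_star :: "nat \<Rightarrow> poly_ady" where
  "tpsi_star n = (\<Sum>i\<le>m_deg n. monom (coeff (tpsi_poly n) i) (m_deg n - i))"

text \<open>\<open>c(u,v)\<close> for \<open>c \<in> \<int>[a,d]\<close>.  Both variables are evaluated at once, so \<open>u\<close> and \<open>v\<close> may
  themselves involve \<open>a\<close> and \<open>d\<close>.\<close>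

definition eval_ad :: "poly_ad \<Rightarrow> poly_ad \<Rightarrow> poly_ad \<Rightarrow> poly_ad" where
  "eval_ad u v c = poly (map_poly (\<lambda>p. poly (map_poly of_int p) u) c) v"

text \<open>\<open>P(u,v,y)\<close> for \<open>P \<in> \<int>[a,d,y]\<close>.\<close>

definition subst_ad :: "poly_ad \<Rightarrow> poly_ad \<Rightarrow> poly_ady \<Rightarrow> poly_ady" where
  "subst_ad u v P = map_poly (eval_ad u v) P"

text \<open>Integrality and degree bound, by induction on \<open>n\<close>.  For even \<open>n\<close> the induction also needs that
  \<open>y + 1\<close> divides \<open>\<psi>\<^sub>n\<close>.\<close>

lemma fy1_nz: "fy + 1 \<noteq> 0"
proof -
  have "fy + 1 = to_fract ([:0, 1:] + 1 :: poly_ady)"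
    by (simp add: fy_def)
  moreover have "([:0, 1:] + 1 :: poly_ady) \<noteq> 0"
    by (simp add: one_pCons)
  ultimately show ?thesis by (simp only: to_fract_eq_0_iff not_False_eq_True)
qed

text \<open>\<open>x\<close> lies in \<open>\<int>[a,d,y]\<close> and has degree at most \<open>k\<close> in \<open>y\<close>.\<close>

definition bd :: "nat \<Rightarrow> ratfun_ady \<Rightarrow> bool" where
  "bd k x \<longleftrightarrow> (\<exists>P. x = to_fract P \<and> degree P \<le> k)"

lemma bd_to_fract: "degree P \<le> k \<Longrightarrow> bd k (to_fract P)"
  unfolding bd_def by blast

lemma bdE:
  assumes "bd k x"
  obtains P where "x = to_fract P" "degree P \<le> k"
  using assms unfolding bd_def by blast

lemma bd_mult:
  assumes "bd k x" "bd l y"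
  shows "bd (k + l) (x * y)"
proof -
  from assms obtain P Q where P: "x = to_fract P" "degree P \<le> k" "y = to_fract Q" "degree Q \<le> l"
    by (elim bdE)
  have "degree (P * Q) \<le> k + l"
    by (rule order_trans[OF degree_mult_le add_mono[OF P(2,4)]])
  then show ?thesis
    unfolding P(1,3) to_fract_mult[symmetric] by (rule bd_to_fract)
qed

lemma bd_power: "bd k x \<Longrightarrow> bd (l * k) (x ^ l)"
proof (induction l)
  case 0
  show ?case unfolding bd_def by (rule exI[of _ 1]) simp
next
  case (Suc l)
  then show ?case using bd_mult[of k x "l * k" "x ^ l"] by simp
qed

lemma bd_add:
  assumes "bd k x" "bd k y"
  shows "bd k (x + y)"
proof -
  from assms obtain P Q where P: "x = to_fract P" "degree P \<le> k" "y = to_fract Q" "degree Q \<le> k"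
    by (elim bdE)
  show ?thesis
    unfolding P(1,3) to_fract_add[symmetric] by (rule bd_to_fract[OF degree_add_le[OF P(2,4)]])
qed

lemma bd_diff:
  assumes "bd k x" "bd k y"
  shows "bd k (x - y)"
proof -
  from assms obtain P Q where P: "x = to_fract P" "degree P \<le> k" "y = to_fract Q" "degree Q \<le> k"
    by (elim bdE)
  show ?thesis
    unfolding P(1,3) to_fract_diff[symmetric] by (rule bd_to_fract[OF degree_diff_le[OF P(2,4)]])
qed

lemma bd_uminus:
  assumes "bd k x"
  shows "bd k (- x)"
proof -
  from assms obtain P where P: "x = to_fract P" "degree P \<le> k"
    by (elim bdE)
  show ?thesis
    unfolding P(1) to_fract_uminus[symmetric] by (rule bd_to_fract) (simp add: P(2))
qed

lemma bd_mono: "bd k x \<Longrightarrow> k \<le> l \<Longrightarrow> bd l x"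
  unfolding bd_def using order_trans by blast

lemma bd_of_nat: "bd 0 (of_nat k)"
proof (induction k)
  case 0
  show ?case unfolding bd_def by (rule exI[of _ 0]) simp
next
  case (Suc k)
  have "bd 0 1" unfolding bd_def by (rule exI[of _ 1]) simp
  from bd_add[OF this Suc] show ?case by simp
qed

lemma bd_basic: "bd 0 fa" "bd 0 fd" "bd 1 fy" "bd 0 1" "bd 0 (numeral w)"
proof -
  show "bd 0 fa" "bd 0 fd" "bd 1 fy"
    unfolding fa_def fd_def fy_def by (rule bd_to_fract, simp)+
  show "bd 0 1" "bd 0 (numeral w)"
    using bd_of_nat[of 1] bd_of_nat[of "numeral w"] by (simp_all only: of_nat_1 of_nat_numeral)
qed

lemma bd_const: "bd 0 (fa - fd)" "bd 0 (4 * (fa - fd))"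
proof -
  show *: "bd 0 (fa - fd)"
    by (rule bd_diff[OF bd_basic(1,2)])
  show "bd 0 (4 * (fa - fd))"
    by (rule bd_mono[OF bd_mult[OF bd_basic(5) *]]) simp
qed

lemma bd_y1: "bd 1 (fy + 1)"
  by (rule bd_add[OF bd_basic(3) bd_mono[OF bd_basic(4) le0]])

lemma bd_curve: "bd 4 ((fa - fd * fy ^ 2) ^ 2)"
proof -
  have "bd 2 (fd * fy ^ 2)"
    by (rule bd_mono[OF bd_mult[OF bd_basic(2) bd_power[OF bd_basic(3)]]]) simp
  then have "bd 2 (fa - fd * fy ^ 2)"
    by (rule bd_diff[OF bd_mono[OF bd_basic(1) le0]])
  then show ?thesis
    by (rule bd_mono[OF bd_power]) simp
qed

definition good :: "nat \<Rightarrow> bool" where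
  "good n \<longleftrightarrow> (if odd n then bd (m_deg n) (tpsi n) else bd (m_deg n - 1) (tpsi n / (fy + 1)))"

lemma m_deg_odd: "m_deg (2 * j + 1) = 2 * j * j + 2 * j"
  by (simp add: m_deg_def power2_eq_square algebra_simps)

lemma m_deg_even: "m_deg (2 * j + 2) = 2 * j * j + 4 * j + 1"
  by (simp add: m_deg_def power2_eq_square algebra_simps)

lemma good_odd: "good (2 * j + 1) \<longleftrightarrow> bd (2 * j * j + 2 * j) (tpsi (2 * j + 1))"
  unfolding good_def m_deg_odd by simp

lemma good_even: "good (2 * j + 2) \<longleftrightarrow> bd (2 * j * j + 4 * j) (tpsi (2 * j + 2) / (fy + 1))"
  unfolding good_def m_deg_even by simp

lemma good_1: "good 1"
proof -
  have "tpsi 1 = 1"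
    by (subst tpsi.simps) simp
  then show ?thesis
    by (simp only: good_def bd_mono[OF bd_basic(4)] le0 odd_one if_True not_False_eq_True)
qed

lemma good_2: "good 2"
proof -
  have "tpsi 2 / (fy + 1) = 1"
    using fy1_nz by (subst tpsi.simps) simp
  then show ?thesis
    unfolding good_def by (simp only: bd_mono[OF bd_basic(4)] le0) simp
qed

lemma good_3: "good 3"
proof -
  have 1: "bd 4 (- fd * fy ^ 4)"
    using bd_mult[OF bd_uminus[OF bd_basic(2)] bd_power[OF bd_basic(3), of 4]] by simp
  have 2: "bd 3 (2 * fd * fy ^ 3)"
    using bd_mult[OF bd_mult[OF bd_basic(5) bd_basic(2)] bd_power[OF bd_basic(3), of 3]] by simp
  have 3: "bd 1 (2 * fa * fy)"
    using bd_mult[OF bd_mult[OF bd_basic(5) bd_basic(1)] bd_basic(3)] by simp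
  have "bd 4 (- fd * fy ^ 4 - 2 * fd * fy ^ 3 + 2 * fa * fy + fa)"
    by (intro bd_add bd_diff 1 bd_mono[OF 2] bd_mono[OF 3] bd_mono[OF bd_basic(1)]) simp_all
  then show ?thesis
    unfolding good_def m_deg_def by (simp add: tpsi.simps[of 3])
qed

lemma good_4: "good 4"
proof -
  have "bd 4 (fd * fy ^ 4 - fa)"
    using bd_diff[OF bd_mult[OF bd_basic(2) bd_power[OF bd_basic(3), of 4]]
        bd_mono[OF bd_basic(1)]] by simp
  from bd_mult[OF bd_mult[OF bd_uminus[OF bd_basic(5)] bd_basic(3)] this]
  have *: "bd (0 + 1 + 4) (- 2 * fy * (fd * fy ^ 4 - fa))" .
  have **: "tpsi 4 = - 2 * fy * (fy + 1) * (fd * fy ^ 4 - fa)"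
    by (simp add: tpsi.simps[of 4])
  have "tpsi 4 / (fy + 1) = - 2 * fy * (fd * fy ^ 4 - fa)"
    unfolding ** nonzero_divide_eq_eq[OF fy1_nz] by (simp only: ac_simps)
  with * have "bd (0 + 1 + 4) (tpsi 4 / (fy + 1))"
    by (simp only:)
  moreover have "0 + 1 + 4 \<le> m_deg 4 - 1" "even (4 :: nat)"
    by (simp_all add: m_deg_def)
  ultimately show ?thesis
    unfolding good_def by (metis bd_mono)
qed

lemma cancel_odd:
  fixes z :: "'a :: field"
  assumes "z \<noteq> 0"
  shows "c * e * (z * u) * (z * v) ^ 3 / z ^ 2 = c * e * z ^ 2 * u * v ^ 3"
  using assms by (simp add: power2_eq_square power3_eq_cube)

lemma cancel_even:
  fixes z :: "'a :: field"
  assumes "z \<noteq> 0"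
  shows "q * (z * u * p - z * v * p') / z = q * (u * p - v * p')"
proof -
  have "q * (z * u * p - z * v * p') = z * (q * (u * p - v * p'))"
    by (simp add: algebra_simps)
  then show ?thesis using assms by (simp only: nonzero_mult_div_cancel_left not_False_eq_True)
qed

lemma cancel_even':
  fixes z :: "'a :: field"
  assumes "z \<noteq> 0"
  shows "p / z * (c * (z * u) ^ 2 - c' * (z * v) ^ 2) / z = p * (c * u ^ 2 - c' * v ^ 2)"
proof -
  have "c * (z * u) ^ 2 - c' * (z * v) ^ 2 = (z * z) * (c * u ^ 2 - c' * v ^ 2)"
    by (simp add: power2_eq_square algebra_simps)
  then show ?thesis using assms by simp
qed

lemma good_step_odd_even:
  assumes "good (2 * j + 1)" "good (2 * j + 2)" "good (2 * (j + 1) + 1)" "good (2 * (j + 1) + 2)"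
  shows "good (2 * (2 * j + 2) + 1)"
proof -
  define q where "q k = tpsi (2 * k + 2) / (fy + 1)" for k
  define p where "p k = tpsi (2 * k + 1)" for k
  define c where "c = (if (2 * j + 2) mod 4 = 0 then 4 * (fa - fd) else 4)"
  have c: "bd 0 c" unfolding c_def using bd_const bd_basic(5) by presburger
  have tq: "tpsi (2 * k + 2) = (fy + 1) * q k" for k
    using fy1_nz by (simp add: q_def)
  have "(2 * j + 2) mod 4 = 0 \<or> (2 * j + 2) mod 4 = 2"
    by presburger
  then have "tpsi (2 * (2 * j + 2) + 1) =
      c * (fa - fd * fy ^ 2) ^ 2 * tpsi (2 * (j + 1) + 2) * tpsi (2 * j + 2) ^ 3 / (fy + 1) ^ 2
        - p j * p (j + 1) ^ 3"
    by (subst tpsi.simps) (auto simp: c_def p_def Let_def)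
  also have "\<dots> = c * (fa - fd * fy ^ 2) ^ 2 * (fy + 1) ^ 2 * q (j + 1) * q j ^ 3
      - p j * p (j + 1) ^ 3"
    unfolding tq by (simp only: cancel_odd[OF fy1_nz])
  finally have *: "tpsi (2 * (2 * j + 2) + 1) = \<dots>" .
  note b = assms[unfolded good_odd good_even, folded p_def q_def]
  show ?thesis
    unfolding good_odd *
    by (intro bd_diff
        bd_mono[OF bd_mult[OF bd_mult[OF bd_mult[OF bd_mult[OF c bd_curve]
          bd_power[OF bd_y1]] b(4)] bd_power[OF b(2)]]]
        bd_mono[OF bd_mult[OF b(1) bd_power[OF b(3)]]])
      (simp_all add: algebra_simps)
qed

lemma good_step_odd_odd:
  assumes "good (2 * j + 2)" "good (2 * (j + 1) + 1)" "good (2 * (j + 1) + 2)" "good (2 * (j + 2) + 1)"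
  shows "good (2 * (2 * j + 3) + 1)"
proof -
  define q where "q k = tpsi (2 * k + 2) / (fy + 1)" for k
  define p where "p k = tpsi (2 * k + 1)" for k
  define c where "c = (if (2 * j + 3) mod 4 = 1 then 4 else 4 * (fa - fd))"
  have c: "bd 0 c" unfolding c_def using bd_const bd_basic(5) by presburger
  have tq: "tpsi (2 * k + 2) = (fy + 1) * q k" for k
    using fy1_nz by (simp add: q_def)
  have r: "2 * j + 3 + 2 = 2 * (j + 2) + 1" "2 * j + 3 - 1 = 2 * j + 2"
    "2 * j + 3 + 1 = 2 * (j + 1) + 2" "2 * j + 3 = 2 * (j + 1) + 1"
    "(2 * (2 * j + 3) + 1) div 2 = 2 * j + 3"
    by simp_all
  have "(2 * j + 3) mod 4 = 1 \<or> (2 * j + 3) mod 4 = 3"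
    by presburger
  then have "tpsi (2 * (2 * j + 3) + 1) =
      tpsi (2 * j + 3 + 2) * tpsi (2 * j + 3) ^ 3
        - c * (fa - fd * fy ^ 2) ^ 2 * tpsi (2 * j + 3 - 1) * tpsi (2 * j + 3 + 1) ^ 3 / (fy + 1) ^ 2"
    by (subst tpsi.simps, unfold Let_def r(5)) (auto simp: c_def)
  also have "\<dots> = p (j + 2) * p (j + 1) ^ 3
      - c * (fa - fd * fy ^ 2) ^ 2 * tpsi (2 * j + 2) * tpsi (2 * (j + 1) + 2) ^ 3 / (fy + 1) ^ 2"
    unfolding r(1-3) p_def by (simp only: r(4))
  also have "\<dots> = p (j + 2) * p (j + 1) ^ 3
      - c * (fa - fd * fy ^ 2) ^ 2 * (fy + 1) ^ 2 * q j * q (j + 1) ^ 3"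
    unfolding tq by (simp only: cancel_odd[OF fy1_nz])
  finally have *: "tpsi (2 * (2 * j + 3) + 1) = \<dots>" .
  note b = assms[unfolded good_odd good_even, folded p_def q_def]
  show ?thesis
    unfolding good_odd *
    by (intro bd_diff
        bd_mono[OF bd_mult[OF bd_mult[OF bd_mult[OF bd_mult[OF c bd_curve]
          bd_power[OF bd_y1]] b(1)] bd_power[OF b(3)]]]
        bd_mono[OF bd_mult[OF b(4) bd_power[OF b(2)]]])
      (simp_all add: algebra_simps)
qed

lemma good_step_even_even:
  assumes "good (2 * j + 2)" "good (2 * (j + 1) + 1)" "good (2 * (j + 1) + 2)"
    "good (2 * (j + 2) + 1)" "good (2 * (j + 2) + 2)"
  shows "good (2 * (2 * j + 3) + 2)"
proof -
  define q where "q k = tpsi (2 * k + 2) / (fy + 1)" for k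
  define p where "p k = tpsi (2 * k + 1)" for k
  have tq: "tpsi (2 * k + 2) = (fy + 1) * q k" for k
    using fy1_nz by (simp add: q_def)
  have r: "2 * j + 4 + 2 = 2 * (j + 2) + 2" "2 * j + 4 - 1 = 2 * (j + 1) + 1"
    "2 * j + 4 + 1 = 2 * (j + 2) + 1" "2 * j + 4 - 2 = 2 * j + 2" "2 * j + 4 = 2 * (j + 1) + 2"
    "(2 * (2 * j + 3) + 2) div 2 = 2 * j + 4"
    by simp_all
  have "(2 * j + 4) mod 4 \<noteq> 1" "(2 * j + 4) mod 4 \<noteq> 3"
    by presburger+
  then have "tpsi (2 * (2 * j + 3) + 2) =
      tpsi (2 * j + 4) / (fy + 1) * (tpsi (2 * j + 4 + 2) * tpsi (2 * j + 4 - 1) ^ 2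
        - tpsi (2 * j + 4 - 2) * tpsi (2 * j + 4 + 1) ^ 2)"
    by (subst tpsi.simps, unfold Let_def r(6)) auto
  also have "\<dots> = q (j + 1) * (tpsi (2 * (j + 2) + 2) * p (j + 1) ^ 2
        - tpsi (2 * j + 2) * p (j + 2) ^ 2)"
    unfolding r(1-4) p_def q_def by (simp only: r(5))
  finally have *: "tpsi (2 * (2 * j + 3) + 2) / (fy + 1) =
      q (j + 1) * (q (j + 2) * p (j + 1) ^ 2 - q j * p (j + 2) ^ 2)"
    unfolding tq by (simp only: cancel_even[OF fy1_nz])
  note b = assms[unfolded good_odd good_even, folded p_def q_def]
  have "bd (6 * j * j + 24 * j + 24) (q (j + 2) * p (j + 1) ^ 2 - q j * p (j + 2) ^ 2)"
    by (intro bd_diff bd_mono[OF bd_mult[OF b(5) bd_power[OF b(2)]]]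
        bd_mono[OF bd_mult[OF b(1) bd_power[OF b(4)]]])
      (simp_all add: algebra_simps)
  from bd_mult[OF b(3) this] show ?thesis
    unfolding good_even * by (rule bd_mono) (simp add: algebra_simps)
qed

lemma good_step_even_odd:
  assumes "good (2 * j + 1)" "good (2 * j + 2)" "good (2 * (j + 1) + 1)" "good (2 * (j + 1) + 2)"
    "good (2 * (j + 2) + 1)"
  shows "good (2 * (2 * j + 2) + 2)"
proof -
  define q where "q k = tpsi (2 * k + 2) / (fy + 1)" for k
  define p where "p k = tpsi (2 * k + 1)" for k
  define c where "c = (if (2 * j + 3) mod 4 = 1 then fa - fd else 1)"
  define c' where "c' = (if (2 * j + 3) mod 4 = 1 then 1 else fa - fd)"
  have c: "bd 0 c" "bd 0 c'" by (simp_all add: c_def c'_def bd_const bd_basic)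
  have tq: "tpsi (2 * k + 2) = (fy + 1) * q k" for k
    using fy1_nz by (simp add: q_def)
  have r: "2 * j + 3 + 2 = 2 * (j + 2) + 1" "2 * j + 3 - 1 = 2 * j + 2"
    "2 * j + 3 + 1 = 2 * (j + 1) + 2" "2 * j + 3 - 2 = 2 * j + 1" "2 * j + 3 = 2 * (j + 1) + 1"
    "(2 * (2 * j + 2) + 2) div 2 = 2 * j + 3"
    by simp_all
  have "(2 * j + 3) mod 4 = 1 \<or> (2 * j + 3) mod 4 = 3"
    by presburger
  then have "tpsi (2 * (2 * j + 2) + 2) =
      tpsi (2 * j + 3) / (fy + 1) * (c * tpsi (2 * j + 3 + 2) * tpsi (2 * j + 3 - 1) ^ 2
        - c' * tpsi (2 * j + 3 - 2) * tpsi (2 * j + 3 + 1) ^ 2)"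
    by (subst tpsi.simps, unfold Let_def r(6)) (auto simp: c_def c'_def)
  also have "\<dots> = p (j + 1) / (fy + 1) * (c * p (j + 2) * tpsi (2 * j + 2) ^ 2
        - c' * p j * tpsi (2 * (j + 1) + 2) ^ 2)"
    unfolding r(1-4) p_def by (simp only: r(5))
  finally have *: "tpsi (2 * (2 * j + 2) + 2) / (fy + 1) =
      p (j + 1) * (c * p (j + 2) * q j ^ 2 - c' * p j * q (j + 1) ^ 2)"
    unfolding tq by (simp only: cancel_even'[OF fy1_nz])
  note b = assms[unfolded good_odd good_even, folded p_def q_def]
  have "bd (6 * j * j + 18 * j + 12) (c * p (j + 2) * q j ^ 2 - c' * p j * q (j + 1) ^ 2)"
    by (intro bd_diff bd_mono[OF bd_mult[OF bd_mult[OF c(1) b(5)] bd_power[OF b(2)]]]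
        bd_mono[OF bd_mult[OF bd_mult[OF c(2) b(1)] bd_power[OF b(4)]]])
      (simp_all add: algebra_simps)
  from bd_mult[OF b(3) this] show ?thesis
    unfolding good_even * by (rule bd_mono) (simp add: algebra_simps)
qed

lemma good: "n \<ge> 1 \<Longrightarrow> good n"
proof (induction n rule: less_induct)
  case (less n)
  note IH = less.IH
  consider "n = 1" | "n = 2" | "n = 3" | "n = 4"
    | j where "n = 2 * (2 * j + 2) + 1" | j where "n = 2 * (2 * j + 2) + 2"
    | j where "n = 2 * (2 * j + 3) + 1" | j where "n = 2 * (2 * j + 3) + 2"
    using less.prems by atomize_elim presburger
  then show ?case
  proof cases
    case (5 j)
    show ?thesis unfolding 5 by (rule good_step_odd_even; rule IH; simp add: 5)
  next
    case (6 j)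
    show ?thesis unfolding 6 by (rule good_step_even_odd; rule IH; simp add: 6)
  next
    case (7 j)
    show ?thesis unfolding 7 by (rule good_step_odd_odd; rule IH; simp add: 7)
  next
    case (8 j)
    show ?thesis unfolding 8 by (rule good_step_even_even; rule IH; simp add: 8)
  qed (simp_all add: good_1[simplified] good_2 good_3 good_4)
qed

lemma tpsi_bd:
  assumes "n \<ge> 1"
  shows "bd (m_deg n) (tpsi n)"
proof (cases "odd n")
  case True
  then show ?thesis using good[OF assms] by (simp add: good_def)
next
  case False
  then have "\<exists>j. n = 2 * j + 2"
    using assms by presburger
  then obtain j where j: "n = 2 * j + 2" ..
  have "bd (1 + (2 * j * j + 4 * j)) ((fy + 1) * (tpsi n / (fy + 1)))"
    using good[OF assms] bd_mult[OF bd_y1] unfolding j good_even by blast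
  then show ?thesis using fy1_nz unfolding j m_deg_even by simp
qed

lemma tpsi_integral:
  shows "to_fract (tpsi_poly n) = tpsi n"
proof -
  have "\<exists>P. to_fract P = tpsi n"
  proof (cases "n = 0")
    case True
    then show ?thesis by (intro exI[of _ 0]) (subst tpsi.simps, simp)
  next
    case False
    then show ?thesis using tpsi_bd[of n] unfolding bd_def by force
  qed
  then obtain P where P: "to_fract P = tpsi n" ..
  then have "(THE P. to_fract P = tpsi n) = P"
    by (intro the_equality) (simp_all only: to_fract_eq_iff flip: P)
  with P show ?thesis
    by (simp only: tpsi_poly_def)
qed

lemma degree_tpsi_poly:
  assumes "n \<ge> 1"
  shows "degree (tpsi_poly n) \<le> m_deg n"
proof -
  from tpsi_bd[OF assms] obtain P where "tpsi n = to_fract P" "degree P \<le> m_deg n"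
    by (rule bdE)
  then show ?thesis
    by (simp only: tpsi_integral[of n, symmetric] to_fract_eq_iff)
qed

end

theory Submission
  imports Defs
begin

text \<open>
  Consider the substitution \<open>\<sigma>\<close> with \<open>a \<mapsto> -d\<close>, \<open>d \<mapsto> -a\<close>, \<open>y \<mapsto> 1/y\<close>.  Reversing the coefficients of
  a polynomial relative to \<open>m\<close> amounts to replacing \<open>y\<close> by \<open>1/y\<close> and multiplying by \<open>y\<^sup>m\<close>, so the
  theorem says that \<open>y\<^sup>m \<sigma>(\<psi>\<^sub>n) = \<psi>\<^sub>n\<close> for \<open>m = m(n)\<close>; call an \<open>x\<close> with \<open>y\<^sup>k \<sigma>(x) = x\<close>
  palindromic of weight \<open>k\<close>.

  Because \<open>\<sigma>\<close> is a ring homomorphism, palindromic elements of equal weight can be added and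
  subtracted, and weights add under multiplication.  They subtract under division, as long as the
  quotient is integral (\<open>pal_cancel\<close>).  Everything in the recursion is built from four palindromic
  atoms: the integers (weight 0), \<open>y + 1\<close> (weight 1), \<open>y\<close> (weight 2) and \<open>a - d y\<^sup>k\<close> (weight
  \<open>k\<close>); for instance \<open>\<psi>\<^sub>3 = (a - d y\<^sup>4) + 2 y (a - d y\<^sup>2)\<close>.  In each recursion formula the two terms
  have the same weight, and that weight is \<open>m(n)\<close>: this is a calculation with the quadratic
  function \<open>m\<close>, in which the weights of \<open>(a - d y\<^sup>2)\<^sup>2\<close> and of the powers of \<open>y + 1\<close> compensate for
  the two parities in the definition of \<open>m\<close>.  The theorem follows by induction on \<open>n\<close>.

  To have \<open>\<sigma>\<close> as an evaluation of polynomials, it is defined only on \<open>\<int>[a,d,y]\<close>, with values in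
  \<open>\<rat>(a,d,y)\<close>.  The integrality of \<open>\<psi>\<^sub>n\<close> makes this sufficient.
\<close>

section \<open>Evaluation of polynomials along a ring homomorphism\<close>

definition ring_hom_map :: "('a :: comm_ring_1 \<Rightarrow> 'b :: comm_ring_1) \<Rightarrow> bool" where
  "ring_hom_map h \<longleftrightarrow> h 1 = 1 \<and> (\<forall>x y. h (x + y) = h x + h y) \<and> (\<forall>x y. h (x * y) = h x * h y)"

lemma ring_hom_mapD:
  assumes "ring_hom_map h"
  shows "h 1 = 1" "h (x + y) = h x + h y" "h (x * y) = h x * h y"
    "h 0 = 0" "h (- x) = - h x" "h (x - y) = h x - h y"
proof -
  show 1: "h 1 = 1" "h (x * y) = h x * h y" and add: "h (x + y) = h x + h y" for x y
    using assms by (simp_all add: ring_hom_map_def)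
  show 0: "h 0 = 0"
    using add[of 0 0] by simp
  show minus: "h (- x) = - h x" for x
    using add[of x "- x"] 0 by (simp add: eq_neg_iff_add_eq_0 add.commute)
  show "h (x - y) = h x - h y"
    using add[of x "- y"] minus[of y] by simp
qed

lemma ring_hom_map_power:
  assumes "ring_hom_map h"
  shows "h (x ^ k) = h x ^ k"
  by (induction k) (simp_all add: ring_hom_mapD[OF assms])

lemma map_poly_add:
  assumes "ring_hom_map h"
  shows "map_poly h (P + Q) = map_poly h P + map_poly h Q"
  by (rule poly_eqI) (simp add: coeff_map_poly ring_hom_mapD[OF assms])

lemma poly_map_poly_pCons:
  assumes "ring_hom_map h"
  shows "poly (map_poly h (pCons c P)) x = h c + x * poly (map_poly h P) x"
  by (simp add: map_poly_pCons ring_hom_mapD[OF assms])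

text \<open>The universal property of polynomial rings.  Applied three times, it makes \<open>\<sigma>\<close> a homomorphism:
  for the inner variable \<open>a\<close>, for \<open>d\<close>, and for \<open>y\<close>.\<close>

lemma ring_hom_map_poly_eval:
  assumes h: "ring_hom_map h"
  shows "ring_hom_map (\<lambda>P. poly (map_poly h P) x)"
proof -
  let ?E = "\<lambda>P. poly (map_poly h P) x"
  note hom = ring_hom_mapD[OF h]
  have add: "?E (P + Q) = ?E P + ?E Q" for P Q
    by (simp add: map_poly_add[OF h])
  have smult: "?E (smult c Q) = h c * ?E Q" for c Q
    by (simp add: map_poly_smult hom)
  have shift: "?E (pCons 0 P) = x * ?E P" for P
    by (simp add: poly_map_poly_pCons[OF h] hom)
  have mult: "?E (P * Q) = ?E P * ?E Q" for P Q
    by (induction P)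
      (simp_all add: add smult shift poly_map_poly_pCons[OF h] hom algebra_simps)
  have "?E 1 = 1"
    by (simp add: hom)
  with add mult show ?thesis
    by (simp add: ring_hom_map_def)
qed

section \<open>The substitution and its palindromic elements\<close>

lemma ring_hom_map_eval_ad: "ring_hom_map (eval_ad u v)"
proof -
  have "ring_hom_map (of_int :: int \<Rightarrow> poly_ad)"
    by (simp add: ring_hom_map_def)
  then show ?thesis
    unfolding eval_ad_def by (intro ring_hom_map_poly_eval)
qed

text \<open>This is \<open>\<sigma>\<close>.\<close>

definition dual :: "poly_ady \<Rightarrow> ratfun_ady" where
  "dual P = poly (map_poly (\<lambda>c. to_fract [:eval_ad (- ind_d) (- ind_a) c:]) P) (1 / fy)"

lemma ring_hom_map_const: "ring_hom_map (\<lambda>c. to_fract [:eval_ad u v c:])"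
  using ring_hom_mapD[OF ring_hom_map_eval_ad[of u v]]
  by (simp add: ring_hom_map_def flip: to_fract_add to_fract_mult one_pCons)

lemma ring_hom_map_dual: "ring_hom_map dual"
  unfolding dual_def by (intro ring_hom_map_poly_eval ring_hom_map_const)

lemmas dual_hom = ring_hom_mapD[OF ring_hom_map_dual]

lemma fy_nonzero: "fy \<noteq> 0"
  by (simp add: fy_def)

lemma dual_atoms:
  shows dual_a: "dual [:ind_a:] = - fd"
    and dual_d: "dual [:ind_d:] = - fa"
    and dual_y: "dual [:0, 1:] = 1 / fy"
proof -
  have of_int_hom: "ring_hom_map (of_int :: int \<Rightarrow> poly_ad)"
    by (simp add: ring_hom_map_def)
  note inner = poly_map_poly_pCons[OF of_int_hom]
  note outer = poly_map_poly_pCons[OF ring_hom_map_poly_eval[OF of_int_hom]]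
  have "eval_ad u v ind_a = u" "eval_ad u v ind_d = v" for u v
    by (simp_all add: eval_ad_def ind_a_def ind_d_def outer inner)
  then show "dual [:ind_a:] = - fd" "dual [:ind_d:] = - fa"
    by (simp_all add: dual_def poly_map_poly_pCons[OF ring_hom_map_const] fa_def fd_def
        flip: to_fract_uminus)
  show "dual [:0, 1:] = 1 / fy"
    using ring_hom_mapD(1,4)[OF ring_hom_map_const[of "- ind_d" "- ind_a"]]
    by (simp add: dual_def poly_map_poly_pCons[OF ring_hom_map_const])
qed

text \<open>The witness \<open>P\<close> is unique, as \<open>to_fract\<close> is injective; it stands for \<open>x\<close> itself, which lies in the
  field where \<open>\<sigma>\<close> is not defined.\<close>

definition pal :: "nat \<Rightarrow> ratfun_ady \<Rightarrow> bool" where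
  "pal k x \<longleftrightarrow> (\<exists>P. x = to_fract P \<and> dual P * fy ^ k = x)"

lemma palI: "dual P * fy ^ k = to_fract P \<Longrightarrow> pal k (to_fract P)"
  unfolding pal_def by blast

lemma palE:
  assumes "pal k x"
  obtains P where "x = to_fract P" "dual P * fy ^ k = to_fract P"
  using assms unfolding pal_def by blast

lemma pal_add:
  assumes "pal k x" "pal k y"
  shows "pal k (x + y)"
proof -
  from assms obtain P Q where
    "x = to_fract P" "dual P * fy ^ k = to_fract P" "y = to_fract Q" "dual Q * fy ^ k = to_fract Q"
    by (elim palE)
  then show ?thesis
    by (simp add: palI dual_hom distrib_right flip: to_fract_add)
qed

lemma pal_diff:
  assumes "pal k x" "pal k y"
  shows "pal k (x - y)"
proof -
  from assms obtain P Q where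
    "x = to_fract P" "dual P * fy ^ k = to_fract P" "y = to_fract Q" "dual Q * fy ^ k = to_fract Q"
    by (elim palE)
  then show ?thesis
    by (simp add: palI dual_hom left_diff_distrib flip: to_fract_diff)
qed

lemma pal_mult:
  assumes "pal k x" "pal l y"
  shows "pal (k + l) (x * y)"
proof -
  from assms obtain P Q where
    PQ: "x = to_fract P" "dual P * fy ^ k = to_fract P" "y = to_fract Q" "dual Q * fy ^ l = to_fract Q"
    by (elim palE)
  have "dual (P * Q) * fy ^ (k + l) = (dual P * fy ^ k) * (dual Q * fy ^ l)"
    by (simp only: dual_hom power_add ac_simps)
  also have "\<dots> = to_fract (P * Q)"
    by (simp only: PQ(2,4) to_fract_mult)
  finally show ?thesis
    unfolding PQ(1,3) to_fract_mult[symmetric] by (rule palI)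
qed

lemma pal_one: "pal 0 1"
  using palI[of 1 0] by (simp add: dual_hom)

lemma pal_power: "pal k x \<Longrightarrow> pal (l * k) (x ^ l)"
proof (induction l)
  case 0
  show ?case by (simp add: pal_one)
next
  case (Suc l)
  then show ?case using pal_mult[of k x "l * k" "x ^ l"] by simp
qed

lemma pal_cong: "pal k x \<Longrightarrow> x = x' \<Longrightarrow> k = k' \<Longrightarrow> pal k' x'"
  by simp

text \<open>A palindromic factor may be cancelled, since \<open>\<sigma>\<close> is multiplicative.  Integrality of \<open>x\<close> is what
  gives \<open>\<sigma>(x)\<close> a meaning.\<close>

lemma pal_cancel:
  assumes xz: "pal (k + l) (x * z)" and z: "pal l z" and nz: "z \<noteq> 0" and int: "x = to_fract P"
  shows "pal k x"
proof -
  from z obtain Q where Q: "z = to_fract Q" "dual Q * fy ^ l = to_fract Q"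
    by (rule palE)
  from xz obtain R where R: "x * z = to_fract R" "dual R * fy ^ (k + l) = to_fract R"
    by (rule palE)
  have "to_fract R = to_fract (P * Q)"
    by (simp only: R(1)[symmetric] int Q(1) to_fract_mult)
  then have "R = P * Q"
    by (simp only: to_fract_eq_iff)
  then have "(dual P * fy ^ k) * (dual Q * fy ^ l) = x * z"
    unfolding R(1) R(2)[symmetric] by (simp only: dual_hom power_add ac_simps)
  then have "dual P * fy ^ k = x"
    using nz unfolding Q(2) Q(1)[symmetric] by simp
  then show ?thesis
    unfolding int by (rule palI)
qed

section \<open>The palindromic atoms\<close>

lemma pal_y: "pal 2 fy"
  unfolding fy_def
  by (rule palI) (simp add: dual_y fy_nonzero power2_eq_square fy_def)

lemma pal_y1: "pal 1 (fy + 1)"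
proof -
  have "dual ([:0, 1:] + 1) * fy ^ 1 = to_fract ([:0, 1:] + 1)"
    unfolding to_fract_add dual_hom dual_y fy_def[symmetric]
    using fy_nonzero by (simp add: field_simps)
  then have "pal 1 (to_fract ([:0, 1:] + 1))"
    by (rule palI)
  then show ?thesis
    by (simp only: fy_def to_fract_add to_fract_1)
qed

text \<open>\<open>\<sigma>\<close> exchanges the two terms of \<open>a - d y\<^sup>k\<close>, up to the factor \<open>y\<^sup>k\<close>.  The case \<open>k = 0\<close> is the
  constant \<open>a - d\<close> of the recursion; \<open>k = 2\<close> and \<open>k = 4\<close> occur in the recursion and in the initial
  values.\<close>

lemma pal_curve: "pal k (fa - fd * fy ^ k)"
proof -
  let ?P = "[:ind_a:] - [:ind_d:] * [:0, 1:] ^ k :: poly_ady"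
  have pow: "to_fract (P ^ k) = to_fract P ^ k" for P :: poly_ady
    by (induction k) simp_all
  have P: "to_fract ?P = fa - fd * fy ^ k"
    unfolding fa_def fd_def fy_def by (simp only: to_fract_diff to_fract_mult pow)
  have "dual ?P * fy ^ k = (- fd + fa * (1 / fy) ^ k) * fy ^ k"
    unfolding dual_hom ring_hom_map_power[OF ring_hom_map_dual] dual_atoms by simp
  also have "\<dots> = to_fract ?P"
    unfolding P using fy_nonzero by (simp add: field_simps)
  finally show ?thesis
    unfolding P[symmetric] by (rule palI)
qed

lemma pal_a_minus_d: "pal 0 (fa - fd)"
  using pal_curve[of 0] by simp

lemma pal_2: "pal 0 2"
  using pal_add[OF pal_one pal_one] by simp

lemma pal_4: "pal 0 4"
  using pal_mult[OF pal_2 pal_2] by simp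

section \<open>The recursion without denominators\<close>

text \<open>Since \<open>a - d\<close> has weight 0, its presence or absence is immaterial for weights.  Isolating it in
  a constant reduces the distinction modulo 4 to one modulo 2.\<close>

lemma tpsi_odd:
  assumes "r \<ge> 2"
  defines "c \<equiv> (if r mod 4 \<in> {0, 3} then fa - fd else 1)"
  shows "tpsi (2 * r + 1) * (fy + 1) ^ 2 =
    (if even r
     then 4 * c * (fa - fd * fy ^ 2) ^ 2 * tpsi (r + 2) * tpsi r ^ 3
       - (fy + 1) ^ 2 * tpsi (r - 1) * tpsi (r + 1) ^ 3
     else (fy + 1) ^ 2 * tpsi (r + 2) * tpsi r ^ 3
       - 4 * c * (fa - fd * fy ^ 2) ^ 2 * tpsi (r - 1) * tpsi (r + 1) ^ 3)"
proof -
  have clear: "(A / z ^ 2 - B) * z ^ 2 = A - z ^ 2 * B" "(B - A / z ^ 2) * z ^ 2 = z ^ 2 * B - A"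
    if "z \<noteq> 0" for A B z :: ratfun_ady
    using that by (simp_all add: algebra_simps)
  consider "r mod 4 = 0" | "r mod 4 = 1" | "r mod 4 = 2" | "r mod 4 = 3"
    by linarith
  then show ?thesis
  proof cases
    case 1
    moreover from 1 have "even r" by presburger
    ultimately show ?thesis
      using assms(1)
      by (subst tpsi.simps) (simp add: c_def clear[OF fy1_nz] mult.assoc Let_def del: One_nat_def)
  next
    case 2
    moreover from 2 have "odd r" by presburger
    ultimately show ?thesis
      using assms(1)
      by (subst tpsi.simps) (simp add: c_def clear[OF fy1_nz] mult.assoc Let_def del: One_nat_def)
  next
    case 3
    moreover from 3 have "even r" by presburger
    ultimately show ?thesis
      using assms(1)
      by (subst tpsi.simps) (simp add: c_def clear[OF fy1_nz] mult.assoc Let_def del: One_nat_def)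
  next
    case 4
    moreover from 4 have "odd r" by presburger
    ultimately show ?thesis
      using assms(1)
      by (subst tpsi.simps) (simp add: c_def clear[OF fy1_nz] mult.assoc Let_def del: One_nat_def)
  qed
qed

lemma tpsi_even:
  assumes "r \<ge> 3"
  shows "tpsi (2 * r) * (fy + 1) =
    tpsi r * ((if r mod 4 = 1 then fa - fd else 1) * tpsi (r + 2) * tpsi (r - 1) ^ 2
      - (if r mod 4 = 3 then fa - fd else 1) * tpsi (r - 2) * tpsi (r + 1) ^ 2)"
proof -
  have "tpsi (2 * r) = tpsi r / (fy + 1) *
    ((if r mod 4 = 1 then fa - fd else 1) * tpsi (r + 2) * tpsi (r - 1) ^ 2
      - (if r mod 4 = 3 then fa - fd else 1) * tpsi (r - 2) * tpsi (r + 1) ^ 2)"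
    (is "_ = _ * ?w")
  proof (cases "r mod 4 = 1 \<or> r mod 4 = 3")
    case True
    then show ?thesis
      using assms by (subst tpsi.simps) (auto simp: Let_def simp del: One_nat_def)
  next
    case False
    then show ?thesis
      using assms by (subst tpsi.simps) (simp add: Let_def del: One_nat_def)
  qed
  moreover have "x / (fy + 1) * w * (fy + 1) = x * w" for x w
    using fy1_nz by simp
  ultimately show ?thesis
    by (simp only:)
qed

section \<open>The division polynomials are palindromic\<close>

lemma pal_tpsi_base: "pal (m_deg 1) (tpsi 1)" "pal (m_deg 2) (tpsi 2)"
  "pal (m_deg 3) (tpsi 3)" "pal (m_deg 4) (tpsi 4)"
proof -
  show "pal (m_deg 1) (tpsi 1)"
    by (rule pal_cong[OF pal_one]) (simp_all add: m_deg_def tpsi.simps[of "Suc 0"])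
  show "pal (m_deg 2) (tpsi 2)"
    by (rule pal_cong[OF pal_y1]) (simp_all add: m_deg_def tpsi.simps[of 2])
  have "pal 4 (2 * fy * (fa - fd * fy ^ 2))"
    by (rule pal_cong[OF pal_mult[OF pal_mult[OF pal_2 pal_y] pal_curve]]) simp_all
  from pal_add[OF pal_curve this] show "pal (m_deg 3) (tpsi 3)"
    by (rule pal_cong)
      (simp_all add: m_deg_def tpsi.simps[of 3] algebra_simps power2_eq_square power3_eq_cube)
  show "pal (m_deg 4) (tpsi 4)"
    by (rule pal_cong[OF pal_mult[OF pal_mult[OF pal_mult[OF pal_2 pal_y] pal_y1] pal_curve[of 4]]])
      (simp_all add: m_deg_def tpsi.simps[of 4] algebra_simps)
qed

text \<open>Up to the parity correction, \<open>m(n)\<close> is \<open>n\<^sup>2/2\<close>: the correction is \<open>-1/2\<close> for odd \<open>n\<close> and \<open>-1\<close> for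
  even \<open>n\<close>.  So a product of four factors of even index falls short of the weight of a product of
  four factors of odd index by an extra 2, and this is made up by \<open>(a - d y\<^sup>2)\<^sup>2\<close>, of weight 4, in place
  of \<open>(y + 1)\<^sup>2\<close>, of weight 2.\<close>

lemma m_deg_recursion_odd:
  assumes r: "r \<ge> 2"
  shows "even r \<Longrightarrow> 4 + m_deg (r + 2) + 3 * m_deg r = m_deg (2 * r + 1) + 2"
    and "even r \<Longrightarrow> 2 + m_deg (r - 1) + 3 * m_deg (r + 1) = m_deg (2 * r + 1) + 2"
    and "odd r \<Longrightarrow> 2 + m_deg (r + 2) + 3 * m_deg r = m_deg (2 * r + 1) + 2"
    and "odd r \<Longrightarrow> 4 + m_deg (r - 1) + 3 * m_deg (r + 1) = m_deg (2 * r + 1) + 2"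
proof -
  define s where "s = r div 2 - 1"
  have m: "m_deg (2 * r + 1) = 2 * r * r + 2 * r"
    by (rule m_deg_odd)
  show "4 + m_deg (r + 2) + 3 * m_deg r = m_deg (2 * r + 1) + 2"
    "2 + m_deg (r - 1) + 3 * m_deg (r + 1) = m_deg (2 * r + 1) + 2" if "even r"
  proof -
    have s: "r = 2 * s + 2"
      using that r by (auto simp: s_def elim!: evenE)
    have m': "m_deg (r - 1) = 2 * s * s + 2 * s" "m_deg r = 2 * s * s + 4 * s + 1"
      "m_deg (r + 1) = 2 * (s + 1) * (s + 1) + 2 * (s + 1)"
      "m_deg (r + 2) = 2 * (s + 1) * (s + 1) + 4 * (s + 1) + 1"
      using m_deg_odd[of s] m_deg_even[of s] m_deg_odd[of "s + 1"] m_deg_even[of "s + 1"]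
      by (simp_all add: s)
    show "4 + m_deg (r + 2) + 3 * m_deg r = m_deg (2 * r + 1) + 2"
      "2 + m_deg (r - 1) + 3 * m_deg (r + 1) = m_deg (2 * r + 1) + 2"
      unfolding m m' by (simp_all add: s algebra_simps)
  qed
  show "2 + m_deg (r + 2) + 3 * m_deg r = m_deg (2 * r + 1) + 2"
    "4 + m_deg (r - 1) + 3 * m_deg (r + 1) = m_deg (2 * r + 1) + 2" if "odd r"
  proof -
    have s: "r = 2 * s + 3"
      using that r by (auto simp: s_def elim!: oddE)
    have m': "m_deg (r - 1) = 2 * s * s + 4 * s + 1"
      "m_deg r = 2 * (s + 1) * (s + 1) + 2 * (s + 1)"
      "m_deg (r + 1) = 2 * (s + 1) * (s + 1) + 4 * (s + 1) + 1"
      "m_deg (r + 2) = 2 * (s + 2) * (s + 2) + 2 * (s + 2)"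
      using m_deg_even[of s] m_deg_odd[of "s + 1"] m_deg_even[of "s + 1"] m_deg_odd[of "s + 2"]
      by (simp_all add: s numeral_eq_Suc)
    show "2 + m_deg (r + 2) + 3 * m_deg r = m_deg (2 * r + 1) + 2"
      "4 + m_deg (r - 1) + 3 * m_deg (r + 1) = m_deg (2 * r + 1) + 2"
      unfolding m m' by (simp_all add: s algebra_simps)
  qed
qed

lemma pal_tpsi_odd:
  assumes r: "r \<ge> 2"
    and IH: "pal (m_deg (r - 1)) (tpsi (r - 1))" "pal (m_deg r) (tpsi r)"
      "pal (m_deg (r + 1)) (tpsi (r + 1))" "pal (m_deg (r + 2)) (tpsi (r + 2))"
  shows "pal (m_deg (2 * r + 1)) (tpsi (2 * r + 1))"
proof (rule pal_cancel)
  note weights = m_deg_recursion_odd[OF r]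
  define c where "c = (if r mod 4 \<in> {0, 3} then fa - fd else 1)"
  have c: "pal 0 c"
    by (simp add: c_def pal_a_minus_d pal_one)
  have K: "pal 4 (4 * c * (fa - fd * fy ^ 2) ^ 2)"
    by (rule pal_cong[OF pal_mult[OF pal_mult[OF pal_4 c] pal_power[OF pal_curve[of 2], of 2]]]) simp_all
  have Z: "pal 2 ((fy + 1) ^ 2)"
    using pal_power[OF pal_y1, of 2] by simp
  have terms: "pal (w + m_deg (r + 2) + 3 * m_deg r) (x * tpsi (r + 2) * tpsi r ^ 3)"
    "pal (w + m_deg (r - 1) + 3 * m_deg (r + 1)) (x * tpsi (r - 1) * tpsi (r + 1) ^ 3)"
    if "pal w x" for w x
    by (intro pal_mult pal_power that IH)+
  show "pal (m_deg (2 * r + 1) + 2) (tpsi (2 * r + 1) * (fy + 1) ^ 2)"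
  proof (cases "even r")
    case True
    show ?thesis
      unfolding tpsi_odd[OF r, folded c_def] if_P[OF True]
      using pal_diff terms(1)[OF K, unfolded weights(1)[OF True]]
        terms(2)[OF Z, unfolded weights(2)[OF True]] by blast
  next
    case False
    show ?thesis
      unfolding tpsi_odd[OF r, folded c_def] if_not_P[OF False]
      using pal_diff terms(1)[OF Z, unfolded weights(3)[OF False]]
        terms(2)[OF K, unfolded weights(4)[OF False]] by blast
  qed
  show "pal 2 ((fy + 1) ^ 2)" by (rule Z)
  show "(fy + 1) ^ 2 \<noteq> 0" using fy1_nz by simp
  show "tpsi (2 * r + 1) = to_fract (tpsi_poly (2 * r + 1))" by (simp only: tpsi_integral)
qed

text \<open>The two terms of the recursion for even index have the same weight, and it is \<open>m(2r) + 1\<close>; the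
  excess 1 is the weight of the denominator \<open>y + 1\<close>.\<close>

lemma m_deg_recursion_even:
  assumes r: "r \<ge> 3"
  shows "m_deg (r + 2) + 2 * m_deg (r - 1) = m_deg (r - 2) + 2 * m_deg (r + 1)"
    and "m_deg r + (m_deg (r - 2) + 2 * m_deg (r + 1)) = m_deg (2 * r) + 1"
proof -
  have m2r: "m_deg (2 * r) + 1 = 2 * r * r"
    using m_deg_even[of "r - 1"] r by (cases r) (simp_all add: algebra_simps)
  have "m_deg (r + 2) + 2 * m_deg (r - 1) = m_deg (r - 2) + 2 * m_deg (r + 1) \<and>
    m_deg r + (m_deg (r - 2) + 2 * m_deg (r + 1)) = m_deg (2 * r) + 1"
  proof (cases "even r")
    case True
    define s where "s = r div 2 - 2"
    have s: "r = 2 * s + 4"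
      using True r by (auto simp: s_def elim!: evenE)
    have m: "m_deg (r - 2) = 2 * s * s + 4 * s + 1"
      "m_deg (r - 1) = 2 * (s + 1) * (s + 1) + 2 * (s + 1)"
      "m_deg r = 2 * (s + 1) * (s + 1) + 4 * (s + 1) + 1"
      "m_deg (r + 1) = 2 * (s + 2) * (s + 2) + 2 * (s + 2)"
      "m_deg (r + 2) = 2 * (s + 2) * (s + 2) + 4 * (s + 2) + 1"
      using m_deg_even[of s] m_deg_odd[of "s + 1"] m_deg_even[of "s + 1"]
        m_deg_odd[of "s + 2"] m_deg_even[of "s + 2"] by (simp_all add: s numeral_eq_Suc)
    show ?thesis
      unfolding m2r m by (simp add: s algebra_simps)
  next
    case False
    define s where "s = r div 2 - 1"
    have s: "r = 2 * s + 3"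
      using False r by (auto simp: s_def elim!: oddE)
    have m: "m_deg (r - 2) = 2 * s * s + 2 * s" "m_deg (r - 1) = 2 * s * s + 4 * s + 1"
      "m_deg r = 2 * (s + 1) * (s + 1) + 2 * (s + 1)"
      "m_deg (r + 1) = 2 * (s + 1) * (s + 1) + 4 * (s + 1) + 1"
      "m_deg (r + 2) = 2 * (s + 2) * (s + 2) + 2 * (s + 2)"
      using m_deg_odd[of s] m_deg_even[of s] m_deg_odd[of "s + 1"] m_deg_even[of "s + 1"]
        m_deg_odd[of "s + 2"] by (simp_all add: s numeral_eq_Suc)
    show ?thesis
      unfolding m2r m by (simp add: s algebra_simps)
  qed
  then show "m_deg (r + 2) + 2 * m_deg (r - 1) = m_deg (r - 2) + 2 * m_deg (r + 1)"
    "m_deg r + (m_deg (r - 2) + 2 * m_deg (r + 1)) = m_deg (2 * r) + 1"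
    by blast+
qed

lemma pal_tpsi_even:
  assumes r: "r \<ge> 3"
    and IH: "pal (m_deg (r - 2)) (tpsi (r - 2))" "pal (m_deg (r - 1)) (tpsi (r - 1))"
      "pal (m_deg r) (tpsi r)" "pal (m_deg (r + 1)) (tpsi (r + 1))"
      "pal (m_deg (r + 2)) (tpsi (r + 2))"
  shows "pal (m_deg (2 * r)) (tpsi (2 * r))"
proof (rule pal_cancel)
  note weights = m_deg_recursion_even[OF r]
  have c: "pal 0 (if b then fa - fd else 1)" for b
    by (simp add: pal_a_minus_d pal_one)
  have 1: "pal (m_deg (r - 2) + 2 * m_deg (r + 1))
      ((if r mod 4 = 1 then fa - fd else 1) * tpsi (r + 2) * tpsi (r - 1) ^ 2)"
    using pal_mult[OF pal_mult[OF c IH(5)] pal_power[OF IH(2), of 2]]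
    unfolding add_0 weights(1) .
  have 2: "pal (m_deg (r - 2) + 2 * m_deg (r + 1))
      ((if r mod 4 = 3 then fa - fd else 1) * tpsi (r - 2) * tpsi (r + 1) ^ 2)"
    using pal_mult[OF pal_mult[OF c IH(1)] pal_power[OF IH(4), of 2]]
    unfolding add_0 .
  show "pal (m_deg (2 * r) + 1) (tpsi (2 * r) * (fy + 1))"
    unfolding tpsi_even[OF r] weights(2)[symmetric] by (intro pal_mult pal_diff IH(3) 1 2)
  show "pal 1 (fy + 1)" by (rule pal_y1)
  show "fy + 1 \<noteq> 0" by (rule fy1_nz)
  show "tpsi (2 * r) = to_fract (tpsi_poly (2 * r))" by (simp only: tpsi_integral)
qed

lemma pal_tpsi: "n \<ge> 1 \<Longrightarrow> pal (m_deg n) (tpsi n)"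
proof (induction n rule: less_induct)
  case (less n)
  consider "n = 1" | "n = 2" | "n = 3" | "n = 4"
    | r where "n = 2 * r + 1" "r \<ge> 2" | r where "n = 2 * r" "r \<ge> 3"
    using less.prems by atomize_elim presburger
  then show ?case
  proof cases
    case (5 r)
    show ?thesis
      unfolding 5(1) by (rule pal_tpsi_odd[OF 5(2)]; rule less.IH; use 5 in simp)
  next
    case (6 r)
    show ?thesis
      unfolding 6(1) by (rule pal_tpsi_even[OF 6(2)]; rule less.IH; use 6 in simp)
  qed (simp_all only: pal_tpsi_base)
qed

section \<open>Coefficient reversal\<close>

text \<open>Since \<open>y\<^sup>-\<^sup>i y\<^sup>m = y\<^sup>m\<^sup>-\<^sup>i\<close> for \<open>i \<le> m\<close>, multiplying \<open>\<sigma>(P)\<close> by \<open>y\<^sup>m\<close> reverses the coefficients.  The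
  degree bound ensures that no power of \<open>y\<close> remains in the denominator.\<close>

lemma dual_eq_reversal:
  assumes "degree P \<le> m"
  shows "dual P * fy ^ m = to_fract (subst_ad (- ind_d) (- ind_a)
    (\<Sum>i\<le>m. monom (coeff P i) (m - i)))"
proof -
  let ?e = "eval_ad (- ind_d) (- ind_a)"
  let ?h = "\<lambda>c. to_fract [:?e c:]"
  note e = ring_hom_mapD[OF ring_hom_map_eval_ad[of "- ind_d" "- ind_a"]]
  have monom: "to_fract (monom c k) = to_fract [:c:] * fy ^ k" for c :: poly_ad and k
  proof (induction k)
    case (Suc k)
    have "monom c (Suc k) = [:0, 1:] * monom c k"
      by (simp add: monom_Suc)
    then show ?case
      by (simp only: to_fract_mult Suc fy_def power_Suc mult.left_commute)
  qed (simp add: monom_0)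
  have "degree (map_poly ?h P) \<le> m"
    using assms by (intro degree_le) (auto simp: coeff_map_poly e coeff_eq_0)
  then have "map_poly ?h P = (\<Sum>i\<le>m. monom (?h (coeff P i)) i)"
    using poly_as_sum_of_monoms'[of "map_poly ?h P" m] by (simp add: coeff_map_poly e)
  then have dual_sum: "dual P = (\<Sum>i\<le>m. ?h (coeff P i) * (1 / fy) ^ i)"
    by (simp add: dual_def poly_sum poly_monom)
  have "dual P * fy ^ m = (\<Sum>i\<le>m. ?h (coeff P i) * (1 / fy) ^ i) * fy ^ m"
    by (simp only: dual_sum)
  also have "\<dots> = (\<Sum>i\<le>m. to_fract (monom (?e (coeff P i)) (m - i)))"
    unfolding sum_distrib_right
  proof (rule sum.cong[OF refl])
    fix i assume "i \<in> {..m}"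
    then have "fy ^ m = fy ^ i * fy ^ (m - i)"
      by (simp flip: power_add)
    then show "?h (coeff P i) * (1 / fy) ^ i * fy ^ m = to_fract (monom (?e (coeff P i)) (m - i))"
      using fy_nonzero by (simp add: monom power_one_over)
  qed
  also have "\<dots> = to_fract (\<Sum>i\<le>m. monom (?e (coeff P i)) (m - i))"
    by (induction m) simp_all
  also have "(\<Sum>i\<le>m. monom (?e (coeff P i)) (m - i)) =
      subst_ad (- ind_d) (- ind_a) (\<Sum>i\<le>m. monom (coeff P i) (m - i))"
  proof -
    have "map_poly ?e (p + q) = map_poly ?e p + map_poly ?e q" for p q
      by (rule map_poly_add[OF ring_hom_map_eval_ad])
    then have "map_poly ?e (sum f A) = (\<Sum>i\<in>A. map_poly ?e (f i))" for f and A :: "nat set"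
      by (induction A rule: infinite_finite_induct) simp_all
    then show ?thesis
      by (simp add: subst_ad_def map_poly_monom e)
  qed
  finally show ?thesis .
qed

theorem theorem7p6:
  fixes n :: nat
  assumes "n \<ge> 1"
  shows "tpsi_poly n = subst_ad (- ind_d) (- ind_a) (tpsi_star n)"
proof -
  obtain P where P: "tpsi n = to_fract P" "dual P * fy ^ m_deg n = to_fract P"
    using pal_tpsi[OF assms] by (rule palE)
  have "P = tpsi_poly n"
    using P(1) by (simp only: tpsi_integral[of n, symmetric] to_fract_eq_iff)
  with P(2) have "to_fract (tpsi_poly n) = dual (tpsi_poly n) * fy ^ m_deg n"
    by simp
  also have "\<dots> = to_fract (subst_ad (- ind_d) (- ind_a) (tpsi_star n))"
    unfolding tpsi_star_def by (rule dual_eq_reversal[OF degree_tpsi_poly[OF assms]])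
  finally show ?thesis
    by (simp only: to_fract_eq_iff)
qed

end
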